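(* Any $3$-dimensional quadratic Jacobi Novikov-Poisson algebra over $\mathbb{C}$ is isomorphic to one of the following $(A=\mathbb{C}e_1\oplus\mathbb{C}e_2\oplus\mathbb{C}e_3,\cdot,\circ,\mathcal{B}(\cdot,\cdot))$, described by $\mathcal{A}=(e_i\cdot e_j)_{i,j}$, $\mathcal{N}=(e_i\circ e_j)_{i,j}$ and the metric matrix $G=(\mathcal{B}(e_i,e_j))_{i,j}$ (all parameters in $\mathbb{C}$). With $\mathcal{A}=\begin{pmatrix} e_1&e_2&e_3\\ e_2&e_3&0\\ e_3&0&0\end{pmatrix}$ and $g_{13}\neq 0$: (J1a) $\mathcal{N}=0$, $G=\begin{pmatrix} g_{11}&g_{12}&g_{13}\\ g_{12}&g_{13}&0\\ g_{13}&0&0\end{pmatrix}$; (J1b) $k_1\neq0$, $k_2=-\frac{k_1}{2}$, $\mathcal{N}=\begin{pmatrix} k_1e_1&k_2e_2+k_3e_3&(2k_2-k_1)e_3\\ k_1e_2&k_2e_3&0\\ k_1e_3&0&0\end{pmatrix}$, $G=\begin{pmatrix} 0&-\frac{2k_3}{3k_1}g_{13}&g_{13}\\ -\frac{2k_3}{3k_1}g_{13}&g_{13}&0\\ g_{13}&0&0\end{pmatrix}$; (J2) $k_1\neq0$, $k_2=-\frac{k_1}{2}$, $\mathcal{N}=\begin{pmatrix} k_1e_1+e_3&k_2e_2+k_3e_3&(2k_2-k_1)e_3\\ k_1e_2&k_2e_3&0\\ k_1e_3&0&0\end{pmatrix}$, $G=\begin{pmatrix} -\frac{1}{k_1}g_{13}&-\frac{2k_3}{3k_1}g_{13}&g_{13}\\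 -\frac{2k_3}{3k_1}g_{13}&g_{13}&0\\ g_{13}&0&0\end{pmatrix}$; (J3) $\mathcal{N}=\begin{pmatrix} k_1e_1+e_2+e_3&k_2e_2+k_3e_3&(2k_2-k_1)e_3\\ k_1e_2+e_3&k_2e_3&0\\ k_1e_3&0&0\end{pmatrix}$ with either $k_1=k_2=0$, $k_3=-2$ and $G=\begin{pmatrix} g_{11}&-g_{13}&g_{13}\\ -g_{13}&g_{13}&0\\ g_{13}&0&0\end{pmatrix}$, or $k_1\neq0$, $k_2=-\frac{k_1}{2}$ and $G=\begin{pmatrix} \frac{-3k_1+2k_3+4}{3k_1^2}g_{13}&-\frac{2k_3+4}{3k_1}g_{13}&g_{13}\\ -\frac{2k_3+4}{3k_1}g_{13}&g_{13}&0\\ g_{13}&0&0\end{pmatrix}$; (J4) $\mathcal{N}=\begin{pmatrix} k_1e_1+e_2&k_2e_2+k_3e_3&(2k_2-k_1)e_3\\ k_1e_2+e_3&k_2e_3&0\\ k_1e_3&0&0\end{pmatrix}$ with either $k_1=k_2=0$, $k_3=-2$ and $G=\begin{pmatrix} g_{11}&0&g_{13}\\ 0&g_{13}&0\\ g_{13}&0&0\end{pmatrix}$, or $k_1\neq0$, $k_2=-\frac{k_1}{2}$ and $G=\begin{pmatrix} \frac{2k_3+4}{3k_1^2}g_{13}&-\frac{2k_3+4}{3k_1}g_{13}&g_{13}\\ -\frac{2k_3+4}{3k_1}g_{13}&g_{13}&0\\ g_{13}&0&0\end{pmatrix}$. With $\mathcal{A}=\begin{pmatrix} e_1&e_2&e_3\\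 e_2&e_2&0\\ e_3&0&0\end{pmatrix}$ and $g_{12}\neq0$, $g_{13}\neq0$: (J5) $k_1\neq0$, $k_2=-k_1$, $k_3=-2k_1$, $\mathcal{N}=\begin{pmatrix} k_1e_1+k_2e_2+e_3&(k_1+k_2)e_2&k_3e_3\\ (k_1+k_2)e_2&(k_1+k_2)e_2&0\\ k_1e_3&0&0\end{pmatrix}$, $G=\begin{pmatrix} g_{12}-\frac{1}{k_1}g_{13}&g_{12}&g_{13}\\ g_{12}&g_{12}&0\\ g_{13}&0&0\end{pmatrix}$; (J6) $\mathcal{N}=\begin{pmatrix} k_1e_1+k_2e_2&(k_1+k_2)e_2&k_3e_3\\ (k_1+k_2)e_2&(k_1+k_2)e_2&0\\ k_1e_3&0&0\end{pmatrix}$ with either $k_1=k_2=k_3=0$ and $G=\begin{pmatrix} g_{11}&g_{12}&g_{13}\\ g_{12}&g_{12}&0\\ g_{13}&0&0\end{pmatrix}$, or $k_1\neq0$, $k_2=-k_1$, $k_3=-2k_1$ and $G=\begin{pmatrix} g_{12}&g_{12}&g_{13}\\ g_{12}&g_{12}&0\\ g_{13}&0&0\end{pmatrix}$. With $\mathcal{A}=\begin{pmatrix} e_1&e_2&e_3\\ e_2&e_2&0\\ e_3&0&e_3\end{pmatrix}$: (J7) $\mathcal{N}=0$, $G=\begin{pmatrix} g_{11}&g_{12}&g_{13}\\ g_{12}&g_{12}&0\\ g_{13}&0&g_{13}\end{pmatrix}$ with $g_{12}\neq0$, $g_{13}\neq0$, $g_{11}\neq g_{12}+g_{13}$.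
   Context: Binary operations are bilinear. A Novikov algebra $(A,\circ)$ is a vector space with a binary operation satisfying $(a\circ b)\circ c-a\circ(b\circ c)=(b\circ a)\circ c-b\circ(a\circ c)$ and $(a\circ b)\circ c=(a\circ c)\circ b$. A Jacobi Novikov-Poisson algebra is a triple $(A,\cdot,\circ)$ where $(A,\cdot)$ is a unital commutative associative algebra with identity $1_A$, $(A,\circ)$ is a Novikov algebra, and $(a\cdot b)\circ c=a\cdot(b\circ c)$, $c\circ(a\cdot b)=(c\circ a)\cdot b+a\cdot(c\circ b)-a\cdot b\cdot(c\circ 1_A)$ for all $a,b,c\in A$. A quadratic Jacobi Novikov-Poisson algebra is $(A,\cdot,\circ,\mathcal{B}(\cdot,\cdot))$ with $(A,\cdot,\circ)$ a Jacobi Novikov-Poisson algebra and $\mathcal{B}$ a nondegenerate symmetric bilinear form with $\mathcal{B}(a\cdot b,c)=\mathcal{B}(a,b\cdot c)$ and $\mathcal{B}(a\circ b,c)=-\mathcal{B}(b,a\circ c+c\circ a)$ for all $a,b,c\in A$. An isomorphism of quadratic Jacobi Novikov-Poisson algebras is a bijective linear map that is a homomorphism for both $\cdot$ (preserving the identity) and $\circ$ and that carries one bilinear form to the other. *)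

theory Defs
  imports "HOL-Analysis.Analysis"
begin

section \<open>Quadratic Jacobi Novikov-Poisson algebras\<close>

text \<open>An algebra is carried by a whole type, with an explicit scalar multiplication.\<close>

definition bilinear_map ::
  "('k::field \<Rightarrow> 'a::ab_group_add \<Rightarrow> 'a) \<Rightarrow> ('k \<Rightarrow> 'b::ab_group_add \<Rightarrow> 'b) \<Rightarrow>
   ('k \<Rightarrow> 'c::ab_group_add \<Rightarrow> 'c) \<Rightarrow> ('a \<Rightarrow> 'b \<Rightarrow> 'c) \<Rightarrow> bool" where
  "bilinear_map s1 s2 s3 f \<longleftrightarrow>
     (\<forall>x. Vector_Spaces.linear s2 s3 (\<lambda>y. f x y)) \<and>
     (\<forall>y. Vector_Spaces.linear s1 s3 (\<lambda>x. f x y))"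

locale comm_unital_algebra =
  vector_space scale + comm_monoid mult unit
  for scale :: "'k::field \<Rightarrow> 'a::ab_group_add \<Rightarrow> 'a"
    and mult :: "'a \<Rightarrow> 'a \<Rightarrow> 'a" (infixl "\<cdot>" 70)
    and unit :: 'a ("\<one>") +
  assumes bilinear_mult: "bilinear_map scale scale scale (\<cdot>)"

locale novikov_algebra = vector_space scale
  for scale :: "'k::field \<Rightarrow> 'a::ab_group_add \<Rightarrow> 'a" +
  fixes nov :: "'a \<Rightarrow> 'a \<Rightarrow> 'a" (infixl "\<star>" 70)
  assumes bilinear_nov: "bilinear_map scale scale scale (\<star>)"
    and left_symmetric:
      "(a \<star> b) \<star> c - a \<star> (b \<star> c) = (b \<star> a) \<star> c - b \<star> (a \<star> c)"
    and right_commutative: "(a \<star> b) \<star> c = (a \<star> c) \<star> b"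

locale jacobi_novikov_poisson_algebra =
  comm_unital_algebra scale mult unit + novikov_algebra scale nov
  for scale :: "'k::field \<Rightarrow> 'a::ab_group_add \<Rightarrow> 'a"
    and mult :: "'a \<Rightarrow> 'a \<Rightarrow> 'a" (infixl "\<cdot>" 70)
    and unit :: 'a ("\<one>")
    and nov :: "'a \<Rightarrow> 'a \<Rightarrow> 'a" (infixl "\<star>" 70) +
  assumes mult_nov: "(a \<cdot> b) \<star> c = a \<cdot> (b \<star> c)"
    and nov_mult: "c \<star> (a \<cdot> b) = (c \<star> a) \<cdot> b + a \<cdot> (c \<star> b) - a \<cdot> b \<cdot> (c \<star> \<one>)"

locale quadratic_jacobi_novikov_poisson_algebra =
  jacobi_novikov_poisson_algebra scale mult unit nov
  for scale :: "'k::field \<Rightarrow> 'a::ab_group_add \<Rightarrow> 'a"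
    and mult :: "'a \<Rightarrow> 'a \<Rightarrow> 'a" (infixl "\<cdot>" 70)
    and unit :: 'a ("\<one>")
    and nov :: "'a \<Rightarrow> 'a \<Rightarrow> 'a" (infixl "\<star>" 70) +
  fixes form :: "'a \<Rightarrow> 'a \<Rightarrow> 'k"
  assumes bilinear_form: "bilinear_map scale scale (*) form"
    and form_sym: "form a b = form b a"
    and form_nondegenerate: "(\<And>b. form a b = 0) \<Longrightarrow> a = 0"
    and form_mult: "form (a \<cdot> b) c = form a (b \<cdot> c)"
    and form_nov: "form (a \<star> b) c = - form b (a \<star> c + c \<star> a)"

text \<open>Both sides of an isomorphism are required to be quadratic Jacobi Novikov-Poisson algebras.\<close>

locale quadratic_jacobi_novikov_poisson_iso =
  source: quadratic_jacobi_novikov_poisson_algebra s1 m1 u1 n1 B1 +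
  target: quadratic_jacobi_novikov_poisson_algebra s2 m2 u2 n2 B2
  for s1 :: "'k::field \<Rightarrow> 'a::ab_group_add \<Rightarrow> 'a"
    and m1 :: "'a \<Rightarrow> 'a \<Rightarrow> 'a" and u1 :: 'a and n1 :: "'a \<Rightarrow> 'a \<Rightarrow> 'a"
    and B1 :: "'a \<Rightarrow> 'a \<Rightarrow> 'k"
    and s2 :: "'k \<Rightarrow> 'b::ab_group_add \<Rightarrow> 'b"
    and m2 :: "'b \<Rightarrow> 'b \<Rightarrow> 'b" and u2 :: 'b and n2 :: "'b \<Rightarrow> 'b \<Rightarrow> 'b"
    and B2 :: "'b \<Rightarrow> 'b \<Rightarrow> 'k" +
  fixes \<phi> :: "'a \<Rightarrow> 'b"
  assumes linear: "Vector_Spaces.linear s1 s2 \<phi>"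
    and bij: "bij \<phi>"
    and hom_mult: "\<phi> (m1 x y) = m2 (\<phi> x) (\<phi> y)"
    and hom_unit: "\<phi> u1 = u2"
    and hom_nov: "\<phi> (n1 x y) = n2 (\<phi> x) (\<phi> y)"
    and isometry: "B2 (\<phi> x) (\<phi> y) = B1 x y"


section \<open>Structures on \<open>\<complex>\<^sup>3\<close> given by tables\<close>

type_synonym mult_table = "complex^3^3^3"
type_synonym gram_matrix = "complex^3^3"

text \<open>The entry \<open>T $ i $ j\<close> of a table is the vector that is the product of the \<open>i\<close>-th and the
  \<open>j\<close>-th standard basis vector.\<close>

definition table_op :: "mult_table \<Rightarrow> complex^3 \<Rightarrow> complex^3 \<Rightarrow> complex^3" where
  "table_op T x y = (\<Sum>i\<in>UNIV. \<Sum>j\<in>UNIV. (x $ i * y $ j) *s (T $ i $ j))"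

definition gram_form :: "gram_matrix \<Rightarrow> complex^3 \<Rightarrow> complex^3 \<Rightarrow> complex" where
  "gram_form G x y = (\<Sum>i\<in>UNIV. \<Sum>j\<in>UNIV. x $ i * y $ j * G $ i $ j)"

abbreviation e1 :: "complex^3" where "e1 \<equiv> axis 1 1"
abbreviation e2 :: "complex^3" where "e2 \<equiv> axis 2 1"
abbreviation e3 :: "complex^3" where "e3 \<equiv> axis 3 1"

abbreviation mat3 :: "'b::zero list list \<Rightarrow> 'b^3^3" where
  "mat3 xss \<equiv> vector (map vector xss)"

definition table_A1 :: mult_table where
  "table_A1 = mat3 [[e1, e2, e3],
                    [e2, e3,  0],
                    [e3,  0,  0]]"

definition table_A2 :: mult_table where
  "table_A2 = mat3 [[e1, e2, e3],
                    [e2, e2,  0],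
                    [e3,  0,  0]]"

definition table_A3 :: mult_table where
  "table_A3 = mat3 [[e1, e2, e3],
                    [e2, e2,  0],
                    [e3,  0, e3]]"

text \<open>\<open>qjnp_list A N G\<close>: the triple (table of \<open>\<cdot>\<close>, table of the Novikov product, metric matrix)
  occurs in the classification list.\<close>

inductive qjnp_list :: "mult_table \<Rightarrow> mult_table \<Rightarrow> gram_matrix \<Rightarrow> bool" where
  J1a: "g13 \<noteq> 0 \<Longrightarrow>
    qjnp_list table_A1 0
      (mat3 [[g11, g12, g13],
             [g12, g13,   0],
             [g13,   0,   0]])"
| J1b: "\<lbrakk>g13 \<noteq> 0; k1 \<noteq> 0; k2 = - k1 / 2\<rbrakk> \<Longrightarrow>
    qjnp_list table_A1
      (mat3 [[k1 *s e1, k2 *s e2 + k3 *s e3, (2 * k2 - k1) *s e3],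
             [k1 *s e2, k2 *s e3,            0],
             [k1 *s e3, 0,                   0]])
      (mat3 [[0,                             - (2 * k3 / (3 * k1)) * g13, g13],
             [- (2 * k3 / (3 * k1)) * g13, g13,                             0],
             [g13,                           0,                               0]])"
| J2: "\<lbrakk>g13 \<noteq> 0; k1 \<noteq> 0; k2 = - k1 / 2\<rbrakk> \<Longrightarrow>
    qjnp_list table_A1
      (mat3 [[k1 *s e1 + e3, k2 *s e2 + k3 *s e3, (2 * k2 - k1) *s e3],
             [k1 *s e2,      k2 *s e3,            0],
             [k1 *s e3,      0,                   0]])
      (mat3 [[- (1 / k1) * g13,            - (2 * k3 / (3 * k1)) * g13, g13],
             [- (2 * k3 / (3 * k1)) * g13, g13,                           0],
             [g13,                         0,                             0]])"
| J3: "\<lbrakk>g13 \<noteq> 0;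
      k1 = 0 \<and> k2 = 0 \<and> k3 = - 2 \<and>
      G = mat3 [[g11,   - g13, g13],
                [- g13,   g13,   0],
                [g13,       0,   0]]
    \<or> k1 \<noteq> 0 \<and> k2 = - k1 / 2 \<and>
      G = mat3 [[(- 3 * k1 + 2 * k3 + 4) / (3 * k1\<^sup>2) * g13, - ((2 * k3 + 4) / (3 * k1)) * g13, g13],
                [- ((2 * k3 + 4) / (3 * k1)) * g13,           g13,                               0],
                [g13,                                         0,                                 0]]\<rbrakk> \<Longrightarrow>
    qjnp_list table_A1
      (mat3 [[k1 *s e1 + e2 + e3, k2 *s e2 + k3 *s e3, (2 * k2 - k1) *s e3],
             [k1 *s e2 + e3,      k2 *s e3,            0],
             [k1 *s e3,           0,                   0]])
      G"
| J4: "\<lbrakk>g13 \<noteq> 0;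
      k1 = 0 \<and> k2 = 0 \<and> k3 = - 2 \<and>
      G = mat3 [[g11,   0, g13],
                [0,   g13,   0],
                [g13,   0,   0]]
    \<or> k1 \<noteq> 0 \<and> k2 = - k1 / 2 \<and>
      G = mat3 [[(2 * k3 + 4) / (3 * k1\<^sup>2) * g13,    - ((2 * k3 + 4) / (3 * k1)) * g13, g13],
                [- ((2 * k3 + 4) / (3 * k1)) * g13, g13,                                 0],
                [g13,                               0,                                   0]]\<rbrakk> \<Longrightarrow>
    qjnp_list table_A1
      (mat3 [[k1 *s e1 + e2, k2 *s e2 + k3 *s e3, (2 * k2 - k1) *s e3],
             [k1 *s e2 + e3, k2 *s e3,            0],
             [k1 *s e3,      0,                   0]])
      G"
| J5: "\<lbrakk>g12 \<noteq> 0; g13 \<noteq> 0; k1 \<noteq> 0; k2 = - k1; k3 = - 2 * k1\<rbrakk> \<Longrightarrow>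
    qjnp_list table_A2
      (mat3 [[k1 *s e1 + k2 *s e2 + e3, (k1 + k2) *s e2, k3 *s e3],
             [(k1 + k2) *s e2,          (k1 + k2) *s e2, 0],
             [k1 *s e3,                 0,               0]])
      (mat3 [[g12 - 1 / k1 * g13, g12, g13],
             [g12,                g12,   0],
             [g13,                  0,   0]])"
| J6: "\<lbrakk>g12 \<noteq> 0; g13 \<noteq> 0;
      k1 = 0 \<and> k2 = 0 \<and> k3 = 0 \<and>
      G = mat3 [[g11, g12, g13],
                [g12, g12,   0],
                [g13,   0,   0]]
    \<or> k1 \<noteq> 0 \<and> k2 = - k1 \<and> k3 = - 2 * k1 \<and>
      G = mat3 [[g12, g12, g13],
                [g12, g12,   0],
                [g13,   0,   0]]\<rbrakk> \<Longrightarrow>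
    qjnp_list table_A2
      (mat3 [[k1 *s e1 + k2 *s e2, (k1 + k2) *s e2, k3 *s e3],
             [(k1 + k2) *s e2,     (k1 + k2) *s e2, 0],
             [k1 *s e3,            0,               0]])
      G"
| J7: "\<lbrakk>g12 \<noteq> 0; g13 \<noteq> 0; g11 \<noteq> g12 + g13\<rbrakk> \<Longrightarrow>
    qjnp_list table_A3 0
      (mat3 [[g11, g12, g13],
             [g12, g12,   0],
             [g13,   0, g13]])"

end

theory Submission
  imports Defs "HOL-Computational_Algebra.Fundamental_Theorem_Algebra"
begin

text \<open>The product \<open>\<star>\<close> of a Jacobi Novikov-Poisson algebra is encoded in the single operator
  \<open>D b = \<one> \<star> b\<close>: putting \<open>a = \<one> \<cdot> a\<close> into the first compatibility condition gives
  \<open>a \<star> b = a \<cdot> D b\<close>, and the second condition says that \<open>D\<close> is a derivation of \<open>\<cdot>\<close> plus the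
  multiplication by \<open>D \<one>\<close>. Likewise the form is encoded in the functional \<open>tr x = B(\<one>, x)\<close>,
  because \<open>B(x, y) = tr (x \<cdot> y)\<close>; the condition that relates \<open>B\<close> to \<open>\<star>\<close> yields the trace
  identity \<open>tr (D x) = - 2 tr (x \<cdot> D \<one>)\<close>. So the task is to list the triples \<open>(A, D, tr)\<close> in
  which \<open>A\<close> is a three-dimensional commutative algebra, \<open>D\<close> an operator of this kind and \<open>tr\<close> a
  nondegenerate functional that satisfies the trace identity.

  The existence of \<open>tr\<close> makes \<open>A\<close> a Frobenius algebra. Every element of \<open>A\<close> is a root of a
  cubic that splits over \<open>\<complex>\<close>. If \<open>0\<close> and \<open>\<one>\<close> are the only idempotents, every element is
  therefore a scalar plus a nilpotent (\<open>connected_local\<close>), and \<open>A\<close> is either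
  \<open>\<complex>[x]/(x\<^sup>3)\<close> or has two independent nilpotents with all products zero
  (\<open>connected_structure\<close>); the latter algebra has a two-dimensional socle, on which a functional
  has a kernel, so it is not Frobenius (\<open>not_square_zero\<close>). If there is another idempotent,
  \<open>A\<close> is \<open>\<complex>\<close> times a two-dimensional algebra, namely \<open>\<complex>[x]/(x\<^sup>2)\<close> or \<open>\<complex> \<times> \<complex>\<close>
  (\<open>disconnected_structure\<close>).

  In each of the three algebras the derivations are easily found, and nondegeneracy forces
  \<open>tr\<close> to be nonzero on every nonzero element that spans an ideal. The trace identity on a basis
  gives linear equations between the coordinates of \<open>D \<one>\<close>, the eigenvalues of \<open>D\<close> and the
  values of \<open>tr\<close>. Automorphisms of \<open>A\<close> bring the nilpotent part of \<open>D \<one>\<close> to the shape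
  \<open>0\<close>, \<open>x\<^sup>2\<close> or \<open>x\<close> in the first algebra and \<open>0\<close> or \<open>x\<close> in the second; on
  \<open>\<complex>\<^sup>3\<close> the equations force \<open>D = 0\<close>. The solutions are the members of the list.\<close>

section \<open>Bilinear operations\<close>

lemma bilinear_mapI:
  assumes "vector_space s1" "vector_space s2" "vector_space s3"
    and "\<And>x y z. f (x + y) z = f x z + f y z" "\<And>x y z. f x (y + z) = f x y + f x z"
    and "\<And>k x y. f (s1 k x) y = s3 k (f x y)" "\<And>k x y. f x (s2 k y) = s3 k (f x y)"
  shows "bilinear_map s1 s2 s3 f"
  using assms by (auto simp: bilinear_map_def Vector_Spaces.linear_iff)

lemma bilinear_mapD:
  assumes "bilinear_map s1 s2 s3 f"
  shows "f (x + y) z = f x z + f y z" "f x (y' + z) = f x y' + f x z"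
    and "f (s1 k x) z = s3 k (f x z)" "f x (s2 k z) = s3 k (f x z)"
  using assms by (auto simp: bilinear_map_def Vector_Spaces.linear_iff)

context comm_unital_algebra
begin

lemma mult_one [simp]: "\<one> \<cdot> a = a" "a \<cdot> \<one> = a"
  by (simp_all add: commute)

lemma mult_add: "a \<cdot> (b + c) = a \<cdot> b + a \<cdot> c" "(a + b) \<cdot> c = a \<cdot> c + b \<cdot> c"
  and mult_scale [simp]: "a \<cdot> scale k b = scale k (a \<cdot> b)" "scale k a \<cdot> b = scale k (a \<cdot> b)"
  using bilinear_mapD[OF bilinear_mult] by auto

lemma mult_zero [simp]: "a \<cdot> 0 = 0" "0 \<cdot> a = 0"
  by (metis mult_scale(1) scale_zero_left, metis mult_scale(2) scale_zero_left)

lemma mult_diff: "a \<cdot> (b - c) = a \<cdot> b - a \<cdot> c" "(a - b) \<cdot> c = a \<cdot> c - b \<cdot> c"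
  by (metis mult_add(1) diff_add_cancel add_diff_cancel, metis mult_add(2) diff_add_cancel add_diff_cancel)

lemma mult_minus [simp]: "a \<cdot> (- b) = - (a \<cdot> b)" "(- a) \<cdot> b = - (a \<cdot> b)"
  using mult_diff(1)[of a 0 b] mult_diff(2)[of 0 a b] by simp_all

lemmas mult_expand = mult_add mult_diff assoc commute left_commute algebra_simps

end

section \<open>Transport of structure\<close>

context quadratic_jacobi_novikov_poisson_algebra
begin

text \<open>Every axiom is an identity, or for nondegeneracy a universal statement, that a bijection
  compatible with the operations reflects. So the domain of \<open>\<psi>\<close> satisfies the axioms as soon as
  its operations are pulled back along \<open>\<psi>\<close>; for operations that are given by tables none of
  them has to be checked by hand.\<close>

lemma isomorphism_of_pullback:
  assumes lin: "Vector_Spaces.linear s scale \<psi>" and bij: "bij \<psi>"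
    and m: "\<And>x y. \<psi> (m x y) = \<psi> x \<cdot> \<psi> y" and u: "\<psi> u = \<one>"
    and n: "\<And>x y. \<psi> (n x y) = \<psi> x \<star> \<psi> y"
    and B: "\<And>x y. B x y = form (\<psi> x) (\<psi> y)"
  shows "quadratic_jacobi_novikov_poisson_iso scale mult unit nov form s m u n B (inv \<psi>)"
proof -
  have V: "vector_space s" and add: "\<psi> (x + y) = \<psi> x + \<psi> y"
    and sc: "\<psi> (s k x) = scale k (\<psi> x)" for x y k
    using lin by (auto simp: Vector_Spaces.linear_iff)
  interpret V: vector_space s by (rule V)
  have diff: "\<psi> (x - y) = \<psi> x - \<psi> y" for x y
    using add[of "x - y" y] by (simp add: algebra_simps)
  have zero: "\<psi> 0 = 0" using diff[of 0 0] by simp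
  have inj: "x = y" if "\<psi> x = \<psi> y" for x y
    using that bij by (meson bij_is_inj injD)
  have surj: "\<psi> (inv \<psi> y) = y" for y
    using bij by (simp add: bij_is_surj surj_f_inv_f)
  have inv: "inv \<psi> (\<psi> x) = x" for x
    using bij by (simp add: bij_is_inj)
  note bil = bilinear_mapD[OF bilinear_mult] bilinear_mapD[OF bilinear_nov]
    bilinear_mapD[OF bilinear_form]
  have VC: "vector_space ((*) :: 'k \<Rightarrow> 'k \<Rightarrow> 'k)"
    using bilinear_form by (auto simp: bilinear_map_def Vector_Spaces.linear_iff)
  have target: "quadratic_jacobi_novikov_poisson_algebra s m u n B"
  proof
    show "bilinear_map s s s m"
      by (rule bilinear_mapI[OF V V V]; rule inj) (simp_all add: m add sc bil)
    show "bilinear_map s s s n"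
      by (rule bilinear_mapI[OF V V V]; rule inj) (simp_all add: n add sc bil)
    show "bilinear_map s s (*) B"
      by (rule bilinear_mapI[OF V V VC]) (simp_all add: B add sc bil)
    show "m (m a b) c = m a (m b c)" for a b c
      by (rule inj) (simp add: m assoc)
    show "m a b = m b a" for a b
      by (rule inj) (simp add: m commute)
    show "m a u = a" for a
      by (rule inj) (simp add: m u)
    show "n (n a b) c - n a (n b c) = n (n b a) c - n b (n a c)" for a b c
      by (rule inj) (simp add: n diff left_symmetric)
    show "n (n a b) c = n (n a c) b" for a b c
      by (rule inj) (simp add: n right_commutative)
    show "n (m a b) c = m a (n b c)" for a b c
      by (rule inj) (simp add: m n mult_nov)
    show "n c (m a b) = m (n c a) b + m a (n c b) - m (m a b) (n c u)" for a b c
      by (rule inj) (simp add: m n u add diff nov_mult)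
    show "B a b = B b a" for a b
      by (simp add: B form_sym)
    show "B (m a b) c = B a (m b c)" for a b c
      by (simp add: B m form_mult)
    show "B (n a b) c = - B b (n a c + n c a)" for a b c
      by (simp add: B n add form_nov)
    show "a = 0" if "\<And>b. B a b = 0" for a
    proof (rule inj)
      have "form (\<psi> a) c = 0" for c
        using that[of "inv \<psi> c"] by (simp add: B surj)
      then show "\<psi> a = \<psi> 0" using form_nondegenerate zero by simp
    qed
  qed
  interpret target: quadratic_jacobi_novikov_poisson_algebra s m u n B by (rule target)
  have vs: "vector_space scale" ..
  have i1: "inv \<psi> (x + y) = inv \<psi> x + inv \<psi> y" for x y
    by (rule inj) (simp add: add surj)
  have i2: "inv \<psi> (scale k x) = s k (inv \<psi> x)" for k x
    by (rule inj) (simp add: sc surj)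
  show ?thesis
  proof (intro quadratic_jacobi_novikov_poisson_iso.intro
      quadratic_jacobi_novikov_poisson_iso_axioms.intro)
    show "quadratic_jacobi_novikov_poisson_algebra scale mult unit nov form" ..
    show "quadratic_jacobi_novikov_poisson_algebra s m u n B" by (rule target)
    show "Vector_Spaces.linear scale s (inv \<psi>)"
      using vs V i1 i2 by (simp add: Vector_Spaces.linear_iff)
    show "bij (inv \<psi>)" using bij by (rule bij_imp_bij_inv)
    show "inv \<psi> (x \<cdot> y) = m (inv \<psi> x) (inv \<psi> y)" for x y
      by (rule inj) (simp add: m surj)
    show "inv \<psi> (x \<star> y) = n (inv \<psi> x) (inv \<psi> y)" for x y
      by (rule inj) (simp add: n surj)
    show "inv \<psi> \<one> = u" using inv[of u] u by simp
    show "B (inv \<psi> x) (inv \<psi> y) = form x y" for x y by (simp add: B surj)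
  qed
qed

end

section \<open>Bases of three-dimensional spaces\<close>

locale vector_space3 = vector_space scale
  for scale :: "'a::field \<Rightarrow> 'b::ab_group_add \<Rightarrow> 'b" +
  assumes dim_UNIV: "dim UNIV = 3"
begin

definition lin_indep3 :: "'b \<Rightarrow> 'b \<Rightarrow> 'b \<Rightarrow> bool" where
  "lin_indep3 x y z \<longleftrightarrow>
    (\<forall>a b c. scale a x + scale b y + scale c z = 0 \<longrightarrow> a = 0 \<and> b = 0 \<and> c = 0)"

lemma lin_indep3D:
  assumes "lin_indep3 x y z" "scale a x + scale b y + scale c z = 0"
  shows "a = 0" "b = 0" "c = 0"
  using assms by (auto simp: lin_indep3_def)

lemma lin_indep3I:
  assumes "x \<noteq> 0" "\<And>a. y \<noteq> scale a x" "\<And>a b. z \<noteq> scale a x + scale b y"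
  shows "lin_indep3 x y z"
  unfolding lin_indep3_def
proof (intro allI impI)
  fix a b c assume eq: "scale a x + scale b y + scale c z = 0"
  have c: "c = 0"
  proof (rule ccontr)
    assume "c \<noteq> 0"
    have "scale c z = scale (- a) x + scale (- b) y"
      using eq by (simp add: algebra_simps eq_neg_iff_add_eq_0)
    then have "scale (1 / c) (scale c z) = scale (1 / c) (scale (- a) x + scale (- b) y)" by simp
    then have "z = scale (- a / c) x + scale (- b / c) y"
      using \<open>c \<noteq> 0\<close> by (simp add: scale_right_distrib scale_right_diff_distrib)
    then show False using assms(3) by blast
  qed
  have b: "b = 0"
  proof (rule ccontr)
    assume "b \<noteq> 0"
    have "scale b y = scale (- a) x"
      using eq c by (simp add: algebra_simps eq_neg_iff_add_eq_0)
    then have "scale (1 / b) (scale b y) = scale (1 / b) (scale (- a) x)" by simp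
    then have "y = scale (- a / b) x"
      using \<open>b \<noteq> 0\<close> by simp
    then show False using assms(2) by blast
  qed
  show "a = 0 \<and> b = 0 \<and> c = 0"
    using eq b c assms(1) by simp
qed

lemma lin_indep3_spans:
  assumes ind: "lin_indep3 x y z"
  obtains a b c where "w = scale a x + scale b y + scale c z"
proof -
  obtain S where S: "independent S" "span S = UNIV" "card S = 3"
    using basis_exists[of UNIV] dim_UNIV by (metis top.extremum_uniqueI)
  then have fin: "finite S" by (metis card.infinite zero_neq_numeral)
  have nz: "x \<noteq> 0" using lin_indep3D(1)[OF ind, of 1 0 0] by auto
  have xy: "y \<notin> span {x}"
    using lin_indep3D(2)[OF ind, of _ "-1" 0] by (auto simp: span_singleton)
  have xyz: "z \<notin> span {y, x}"
  proof
    assume "z \<in> span {y, x}"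
    then obtain k l where "z - scale k y = scale l x"
      by (auto simp: span_breakdown_eq span_singleton)
    then have "scale l x + scale k y + scale (- 1) z = 0" by (simp add: algebra_simps)
    from lin_indep3D(3)[OF ind this] show False by simp
  qed
  have "independent {z, y, x}"
    using nz xy xyz by (intro independent_insertI independent_empty) auto
  moreover have "card {z, y, x} = 3"
    using nz xy xyz by (auto simp: span_base card_insert_if)
  ultimately have "w \<in> span {z, y, x}"
    using independent_insertI[of w "{z, y, x}"] independent_span_bound[OF fin, of "insert w {z, y, x}"]
      S span_base[of w "{z, y, x}"]
    by (cases "w \<in> {z, y, x}") (auto simp: card_insert_if split: if_splits)
  then obtain c b a where "w - scale c z - scale b y = scale a x"
    by (auto simp: span_breakdown_eq span_singleton)
  then have "w = scale a x + scale b y + scale c z" by (simp add: algebra_simps)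
  then show ?thesis by (rule that)
qed

lemma exists_outside_plane:
  obtains w where "\<And>a b. w \<noteq> scale a x + scale b y"
proof -
  have "span {x, y} \<noteq> UNIV"
  proof
    assume "span {x, y} = UNIV"
    then have "dim UNIV \<le> card {x, y}"
      using dim_le_card[of UNIV "{x, y}"] by simp
    also have "\<dots> \<le> 2" by (simp add: card_insert_le_m1)
    finally show False using dim_UNIV by simp
  qed
  then obtain w where "w \<notin> span {x, y}" by auto
  then have "w \<noteq> scale a x + scale b y" for a b
    by (auto intro: span_add span_scale span_base)
  then show ?thesis by (rule that)
qed

lemma basis_combination_bij:
  fixes v :: "'b^3"
  assumes ind: "lin_indep3 (v $ 1) (v $ 2) (v $ 3)"
  shows "bij (\<lambda>c :: 'a^3. \<Sum>i\<in>UNIV. scale (c $ i) (v $ i))" (is "bij ?f")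
proof (rule bijI)
  show "inj ?f"
  proof (rule injI)
    fix c d :: "'a^3" assume "?f c = ?f d"
    then have "scale (c$1 - d$1) (v$1) + scale (c$2 - d$2) (v$2) + scale (c$3 - d$3) (v$3) = 0"
      by (simp add: sum_3 algebra_simps)
    from lin_indep3D[OF ind this] show "c = d" by (simp add: vec_eq_iff forall_3)
  qed
  show "surj ?f"
  proof (rule surjI)
    fix w
    obtain a b c where "w = scale a (v$1) + scale b (v$2) + scale c (v$3)"
      using lin_indep3_spans[OF ind] .
    then have "?f (vector [a, b, c]) = w" by (simp add: sum_3)
    then show "?f (SOME c. ?f c = w) = w" by (rule someI)
  qed
qed

end

section \<open>Splitting polynomials over the complex numbers\<close>

lemma monic_quadratic_splits:
  fixes c d :: complex
  obtains r s where "r + s = c" "r * s = d"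
proof
  let ?q = "csqrt (c\<^sup>2 - 4 * d)"
  show "(c + ?q) / 2 + (c - ?q) / 2 = c" by (simp add: field_simps)
  have "(c + ?q) / 2 * ((c - ?q) / 2) = (c\<^sup>2 - ?q\<^sup>2) / 4" by (simp add: field_simps power2_eq_square)
  then show "(c + ?q) / 2 * ((c - ?q) / 2) = d" by simp
qed

lemma monic_cubic_splits:
  fixes b c d :: complex
  obtains r s t where "r + s + t = b" "r * s + r * t + s * t = c" "r * s * t = d"
proof -
  let ?p = "[:- d, c, - b, 1:]"
  obtain r where "poly ?p r = 0"
    using fundamental_theorem_of_algebra[of ?p] by (auto simp: constant_degree)
  then have r: "r * (r * r - b * r + c) = d" by (simp add: algebra_simps)
  obtain s t where st: "s + t = b - r" "s * t = r * r - b * r + c"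
    using monic_quadratic_splits .
  have 1: "r + s + t = b" using st(1) by (simp add: algebra_simps)
  have "r * s + r * t + s * t = r * (s + t) + s * t" by (simp add: algebra_simps)
  also have "\<dots> = c" unfolding st by (simp add: algebra_simps)
  finally have 2: "r * s + r * t + s * t = c" .
  have 3: "r * s * t = d" using r st(2) by (simp add: mult.assoc)
  show ?thesis using that 1 2 3 by blast
qed

section \<open>Three-dimensional commutative algebras\<close>

context comm_unital_algebra
begin

lemma quadratic_expand:
  "(x - scale r \<one>) \<cdot> (x - scale s \<one>) = x \<cdot> x - scale (r + s) x + scale (r * s) \<one>"
  by (simp add: mult_expand)

lemma cubic_expand:
  "(x - scale r \<one>) \<cdot> ((x - scale s \<one>) \<cdot> (x - scale t \<one>)) =
    x \<cdot> x \<cdot> x - scale (r + s + t) (x \<cdot> x) + scale (r * s + r * t + s * t) x - scale (r * s * t) \<one>"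
  by (simp add: mult_expand)

lemma scaled_idempotent:
  assumes "q \<cdot> q = scale k q" "k \<noteq> 0"
  shows "scale (1 / k) q \<cdot> scale (1 / k) q = scale (1 / k) q"
  using assms by simp

lemma scale_eq_imp:
  assumes "scale (1 / k) q = y" "k \<noteq> 0"
  shows "q = scale k y"
  using assms by auto

text \<open>If \<open>r \<noteq> s\<close>, the element \<open>(x - r) / (s - r)\<close> is idempotent: it is the idempotent that the
  Chinese remainder theorem attaches to the root \<open>s\<close>.\<close>

lemma connected_quadratic_root:
  assumes conn: "\<And>e. e \<cdot> e = e \<Longrightarrow> e = 0 \<or> e = \<one>"
    and eq: "(x - scale r \<one>) \<cdot> (x - scale s \<one>) = 0" and "r \<noteq> s"
  shows "x = scale r \<one> \<or> x = scale s \<one>"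
proof -
  let ?q = "x - scale r \<one>"
  have "?q \<cdot> ?q = ?q \<cdot> (x - scale s \<one>) + scale (s - r) ?q"
    by (simp add: mult_expand)
  then have q: "?q \<cdot> ?q = scale (s - r) ?q" using eq by simp
  have k: "s - r \<noteq> 0" using \<open>r \<noteq> s\<close> by simp
  from conn[OF scaled_idempotent[OF q k]]
  show ?thesis
  proof
    assume "scale (1 / (s - r)) ?q = 0"
    from scale_eq_imp[OF this k] show ?thesis by simp
  next
    assume "scale (1 / (s - r)) ?q = \<one>"
    from scale_eq_imp[OF this k] have "x = scale s \<one>" by (simp add: algebra_simps)
    then show ?thesis by simp
  qed
qed

text \<open>The product \<open>q = (x - s)(x - t)\<close> is an eigenvector of \<open>x\<close> with eigenvalue \<open>r\<close>, so
  \<open>q\<^sup>2 = (r - s)(r - t) q\<close> and a multiple of \<open>q\<close> is idempotent. If that idempotent is \<open>0\<close>, the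
  element \<open>x\<close> satisfies a quadratic; if it is \<open>\<one>\<close>, then \<open>x = r\<close>.\<close>

lemma connected_simple_root:
  assumes conn: "\<And>e. e \<cdot> e = e \<Longrightarrow> e = 0 \<or> e = \<one>"
    and eq: "(x - scale r \<one>) \<cdot> ((x - scale s \<one>) \<cdot> (x - scale t \<one>)) = 0"
    and "r \<noteq> s" "r \<noteq> t"
  shows "\<exists>l. (x - scale l \<one>) \<cdot> (x - scale l \<one>) = 0"
proof -
  let ?q = "(x - scale s \<one>) \<cdot> (x - scale t \<one>)"
  let ?k = "(r - s) * (r - t)"
  have k: "?k \<noteq> 0" using assms by simp
  have act: "(x - scale l \<one>) \<cdot> ?q = scale (r - l) ?q" for l
  proof -
    have "(x - scale l \<one>) \<cdot> y = (x - scale r \<one>) \<cdot> y + scale (r - l) y" for y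
      by (simp add: mult_diff(2) scale_left_diff_distrib)
    from this[of ?q] show ?thesis using eq by simp
  qed
  have "?q \<cdot> ?q = (x - scale s \<one>) \<cdot> ((x - scale t \<one>) \<cdot> ?q)"
    by (simp only: assoc)
  also have "\<dots> = scale ?k ?q"
    unfolding act mult_scale by (simp add: mult.commute)
  finally have q: "?q \<cdot> ?q = scale ?k ?q" .
  from conn[OF scaled_idempotent[OF q k]]
  show ?thesis
  proof
    assume "scale (1 / ?k) ?q = 0"
    from scale_eq_imp[OF this k] have q0: "?q = 0" by simp
    show ?thesis
    proof (cases "s = t")
      case True then show ?thesis using q0 by blast
    next
      case False
      from connected_quadratic_root[OF conn q0 this] show ?thesis by (metis diff_self mult_zero(1))
    qed
  next
    assume "scale (1 / ?k) ?q = \<one>"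
    from scale_eq_imp[OF this k] have "scale ?k (x - scale r \<one>) = 0"
      using eq by simp
    then have "x - scale r \<one> = 0" using k by (simp only: scale_eq_0_iff) simp
    then show ?thesis by (metis mult_zero(1))
  qed
qed

text \<open>Among three roots that are not all equal, one differs from the other two.\<close>

lemma connected_local:
  assumes conn: "\<And>e. e \<cdot> e = e \<Longrightarrow> e = 0 \<or> e = \<one>"
    and eq: "(x - scale r \<one>) \<cdot> ((x - scale s \<one>) \<cdot> (x - scale t \<one>)) = 0"
  shows "\<exists>l. (x - scale l \<one>) \<cdot> (x - scale l \<one>) \<cdot> (x - scale l \<one>) = 0"
proof -
  have eq2: "(x - scale s \<one>) \<cdot> ((x - scale r \<one>) \<cdot> (x - scale t \<one>)) = 0"
    using eq by (simp only: left_commute)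
  have eq3: "(x - scale t \<one>) \<cdot> ((x - scale r \<one>) \<cdot> (x - scale s \<one>)) = 0"
    using eq by (metis commute left_commute)
  consider "r = s" "r = t" | "r \<noteq> s" "r \<noteq> t" | "s \<noteq> r" "s \<noteq> t" | "t \<noteq> r" "t \<noteq> s" by metis
  then show ?thesis
  proof cases
    case 1 then show ?thesis using eq by (metis assoc)
  next
    case 2 from connected_simple_root[OF conn eq 2] show ?thesis by (metis mult_zero(2))
  next
    case 3 from connected_simple_root[OF conn eq2 3] show ?thesis by (metis mult_zero(2))
  next
    case 4 from connected_simple_root[OF conn eq3 4] show ?thesis by (metis mult_zero(2))
  qed
qed

end

locale complex_algebra3 = comm_unital_algebra scale mult unit + vector_space3 scale
  for scale :: "complex \<Rightarrow> 'a::ab_group_add \<Rightarrow> 'a"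
    and mult :: "'a \<Rightarrow> 'a \<Rightarrow> 'a" (infixl "\<cdot>" 70)
    and unit :: 'a ("\<one>")
begin

lemma nilpotent_powers_indep:
  assumes "x \<cdot> x \<cdot> x = 0" "x \<cdot> x \<noteq> 0"
  shows "lin_indep3 \<one> x (x \<cdot> x)"
  unfolding lin_indep3_def
proof (intro allI impI)
  fix a b c assume eq: "scale a \<one> + scale b x + scale c (x \<cdot> x) = 0"
  have x3: "x \<cdot> (x \<cdot> x) = 0" using assms(1) by (simp add: assoc)
  have "x \<cdot> x \<cdot> (scale a \<one> + scale b x + scale c (x \<cdot> x)) = scale a (x \<cdot> x)"
    by (simp add: mult_add assoc x3)
  then have a: "a = 0" using eq assms(2) by simp
  have "x \<cdot> (scale a \<one> + scale b x + scale c (x \<cdot> x)) = scale b (x \<cdot> x)"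
    by (simp add: mult_add a x3)
  then have b: "b = 0" using eq assms(2) by simp
  show "a = 0 \<and> b = 0 \<and> c = 0" using eq a b assms(2) by simp
qed


lemma unit_nonzero: "\<one> \<noteq> 0"
proof
  assume "\<one> = 0"
  then have "w = 0" for w :: 'a using mult_one(1)[of w] by simp
  then show False using exists_outside_plane[of 0 0] by auto
qed

lemma annihilating_cubic:
  "\<exists>r s t. (x - scale r \<one>) \<cdot> ((x - scale s \<one>) \<cdot> (x - scale t \<one>)) = 0"
proof (cases "lin_indep3 \<one> x (x \<cdot> x)")
  case True
  obtain a b c where abc: "x \<cdot> x \<cdot> x = scale a \<one> + scale b x + scale c (x \<cdot> x)"
    using lin_indep3_spans[OF True] .
  obtain r s t where "r + s + t = c" "r * s + r * t + s * t = - b" "r * s * t = a"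
    using monic_cubic_splits .
  then have "(x - scale r \<one>) \<cdot> ((x - scale s \<one>) \<cdot> (x - scale t \<one>)) = 0"
    unfolding cubic_expand abc by simp
  then show ?thesis by blast
next
  case False
  show ?thesis
  proof (cases "\<exists>a. x = scale a \<one>")
    case True then show ?thesis by (metis mult_zero(2) right_minus_eq)
  next
    case x: False
    then obtain a b where ab: "x \<cdot> x = scale a \<one> + scale b x"
      using False lin_indep3I[OF unit_nonzero, of x "x \<cdot> x"] by blast
    obtain r s where "r + s = b" "r * s = - a" using monic_quadratic_splits .
    then have "(x - scale r \<one>) \<cdot> (x - scale s \<one>) = 0"
      unfolding quadratic_expand ab by simp
    then show ?thesis by (metis mult_zero(1))
  qed
qed

text \<open>By \<open>connected_local\<close> there is a basis that consists of \<open>\<one>\<close> and two nilpotents \<open>u\<close>, \<open>v\<close> of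
  index at most three. If both squares vanish but \<open>u \<cdot> v\<close> does not, then \<open>u + v\<close> has the square
  \<open>2 u \<cdot> v\<close> and generates the algebra.\<close>

lemma connected_structure:
  assumes conn: "\<And>e. e \<cdot> e = e \<Longrightarrow> e = 0 \<or> e = \<one>"
  obtains (uniserial) x where "x \<cdot> x \<cdot> x = 0" "x \<cdot> x \<noteq> 0"
  | (square_zero) u v where "lin_indep3 \<one> u v" "u \<cdot> u = 0" "v \<cdot> v = 0" "u \<cdot> v = 0"
proof -
  have nil: "\<exists>l. (x - scale l \<one>) \<cdot> (x - scale l \<one>) \<cdot> (x - scale l \<one>) = 0" for x
    using connected_local[OF conn] annihilating_cubic[of x] by metis
  obtain y where y: "\<And>a b. y \<noteq> scale a \<one> + scale b \<one>"
    using exists_outside_plane[of \<one> \<one>] by blast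
  obtain l where u3: "(y - scale l \<one>) \<cdot> (y - scale l \<one>) \<cdot> (y - scale l \<one>) = 0" using nil by blast
  define u where "u = y - scale l \<one>"
  obtain z where z: "\<And>a b. z \<noteq> scale a \<one> + scale b u"
    using exists_outside_plane[of \<one> u] by blast
  obtain m where v3: "(z - scale m \<one>) \<cdot> (z - scale m \<one>) \<cdot> (z - scale m \<one>) = 0" using nil by blast
  define v where "v = z - scale m \<one>"
  have u: "u \<noteq> scale a \<one>" for a
    using y[of a l] by (auto simp: u_def algebra_simps)
  have v: "v \<noteq> scale a \<one> + scale b u" for a b
    using z[of "a + m" b] by (auto simp: v_def algebra_simps)
  have ind: "lin_indep3 \<one> u v"
    using lin_indep3I unit_nonzero u v by blast
  show ?thesis
  proof (cases "u \<cdot> u = 0 \<and> v \<cdot> v = 0")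
    case False
    then show ?thesis using uniserial u3 v3 u_def v_def by metis
  next
    case True
    then have uu: "u \<cdot> u = 0" and vv: "v \<cdot> v = 0" by auto
    have uuw: "u \<cdot> (u \<cdot> w) = 0" and vvw: "v \<cdot> (v \<cdot> w) = 0" for w
      by (metis assoc uu vv mult_zero(2))+
    show ?thesis
    proof (cases "u \<cdot> v = 0")
      case True
      then show ?thesis using square_zero ind uu vv by blast
    next
      case False
      have sq: "(u + v) \<cdot> (u + v) = scale 2 (u \<cdot> v)"
        using scale_left_distrib[of 1 1 "u \<cdot> v"] by (simp add: mult_add uu vv commute)
      then have "(u + v) \<cdot> (u + v) \<noteq> 0" using False by simp
      moreover have "(u + v) \<cdot> (u + v) \<cdot> (u + v) = 0"
        unfolding sq by (simp add: mult_add assoc commute left_commute uu vv uuw vvw)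
      ultimately show ?thesis using uniserial by blast
    qed
  qed
qed

text \<open>One of the two ideals of the decomposition given by an idempotent is two-dimensional. Let \<open>f\<close> be
  the idempotent, \<open>e\<close> or \<open>\<one> - e\<close>, that annihilates this ideal, and \<open>w\<close> an element of the
  ideal off the line of its unit \<open>\<one> - f\<close>. Inside the ideal \<open>w\<close> has a monic quadratic
  equation with roots \<open>r\<close>, \<open>s\<close>. The shift \<open>n = w - r (\<one> - f)\<close> satisfies
  \<open>n\<^sup>2 = (s - r) n\<close>: it is nilpotent for a double root and a multiple of an idempotent
  otherwise.\<close>

lemma disconnected_structure:
  assumes e: "e \<cdot> e = e" "e \<noteq> 0" "e \<noteq> \<one>"
  obtains (dual_numbers) e n where
    "lin_indep3 \<one> e n" "e \<cdot> e = e" "e \<cdot> n = 0" "n \<cdot> n = 0"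
  | (split) e h where
    "lin_indep3 \<one> e h" "e \<cdot> e = e" "e \<cdot> h = 0" "h \<cdot> h = h"
proof -
  have nonscalar: "f \<noteq> scale a \<one>" if f: "f \<cdot> f = f" "f \<noteq> 0" "f \<noteq> \<one>" for f a
  proof
    assume fa: "f = scale a \<one>"
    then have "scale (a * a) \<one> = scale a \<one>" using f(1) by simp
    then have "a = 0 \<or> a = 1" using unit_nonzero by simp
    then show False using f fa by auto
  qed
  obtain v where v: "\<And>a b. v \<noteq> scale a \<one> + scale b e"
    using exists_outside_plane[of \<one> e] by blast
  obtain f w where f: "f \<cdot> f = f" "f \<noteq> 0" "f \<noteq> \<one>" and fw: "f \<cdot> w = 0"
    and w: "\<And>a b. w \<noteq> scale a \<one> + scale b f"
  proof (cases "\<exists>a b. v - e \<cdot> v = scale a \<one> + scale b e")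
    case False
    have "e \<cdot> (v - e \<cdot> v) = 0"
      using assoc[of e e v] e(1) by (simp add: mult_diff)
    then show ?thesis using that[of e "v - e \<cdot> v"] e False by blast
  next
    case True
    then obtain a b where ab: "v - e \<cdot> v = scale a \<one> + scale b e" by blast
    have "e \<cdot> v \<noteq> scale c \<one> + scale d (\<one> - e)" for c d
    proof
      assume ev: "e \<cdot> v = scale c \<one> + scale d (\<one> - e)"
      have "v = (v - e \<cdot> v) + e \<cdot> v" by simp
      also have "\<dots> = scale (a + c + d) \<one> + scale (b - d) e"
        unfolding ab unfolding ev by (simp add: algebra_simps)
      finally have "v = scale (a + c + d) \<one> + scale (b - d) e" .
      then show False using v by blast
    qed
    moreover have "(\<one> - e) \<cdot> (\<one> - e) = \<one> - e" using e(1) by (simp add: mult_diff)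
    moreover have "(\<one> - e) \<cdot> (e \<cdot> v) = 0"
      using assoc[of e e v] e(1) by (simp add: mult_diff)
    ultimately show ?thesis using that[of "\<one> - e" "e \<cdot> v"] e by auto
  qed
  have ind: "lin_indep3 \<one> f (scale c (w - scale r (\<one> - f)))" if "c \<noteq> 0" for c r
  proof (rule lin_indep3I)
    show "\<one> \<noteq> 0" by (rule unit_nonzero)
    show "f \<noteq> scale a \<one>" for a using nonscalar f by blast
    show "scale c (w - scale r (\<one> - f)) \<noteq> scale a \<one> + scale b f" for a b
    proof
      assume "scale c (w - scale r (\<one> - f)) = scale a \<one> + scale b f"
      then have "scale (1 / c) (scale c (w - scale r (\<one> - f))) = scale (1 / c) (scale a \<one> + scale b f)"
        by simp
      then have "w - scale r (\<one> - f) = scale (a / c) \<one> + scale (b / c) f"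
        using that by (simp add: scale_right_distrib)
      then have "w = scale (a / c + r) \<one> + scale (b / c - r) f"
        by (simp add: algebra_simps)
      then show False using w by blast
    qed
  qed
  have "lin_indep3 \<one> f w"
    using ind[of 1 0] by simp
  then obtain a b c where ww: "w \<cdot> w = scale a \<one> + scale b f + scale c w"
    using lin_indep3_spans by blast
  \<comment> \<open>The square of \<open>w\<close> stays in the ideal, so its \<open>f\<close>-component vanishes.\<close>
  have "f \<cdot> (w \<cdot> w) = 0" using assoc[of f w w] fw by simp
  then have "scale (a + b) f = 0"
    by (simp add: ww mult_add f(1) fw scale_left_distrib)
  then have b: "b = - a" using f(2) by (simp add: add_eq_0_iff)
  obtain r s where rs: "r + s = c" "r * s = - a" using monic_quadratic_splits .
  have g: "(\<one> - f) \<cdot> w = w" "(\<one> - f) \<cdot> (\<one> - f) = \<one> - f"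
    using f(1) fw by (simp_all add: mult_diff)
  define n where "n = w - scale r (\<one> - f)"
  have fn: "f \<cdot> n = 0" by (simp add: n_def mult_diff fw f(1))
  have square: "(w - scale r g) \<cdot> (w - scale r g) =
      w \<cdot> w - (scale r (w \<cdot> g) + scale r (g \<cdot> w)) + scale (r * r) (g \<cdot> g)" for g
    by (simp add: mult_diff scale_right_diff_distrib)
  have "n \<cdot> n = w \<cdot> w - scale (2 * r) w + scale (r * r) (\<one> - f)"
    using g(1,2) commute[of w "\<one> - f"] square[of "\<one> - f"]
    by (simp add: n_def scale_left_distrib[symmetric])
  also have "\<dots> = scale (c - 2 * r) w + scale (a + r * r) (\<one> - f)"
    unfolding ww b by (simp add: algebra_simps)
  also have "a + r * r = - (r * (s - r))" using rs(2) by (simp add: algebra_simps)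
  also have "c - 2 * r = s - r" using rs(1) by simp
  finally have nn: "n \<cdot> n = scale (s - r) n"
    by (simp add: n_def scale_right_diff_distrib mult.commute)
  show ?thesis
  proof (cases "s = r")
    case True
    then show ?thesis
      using dual_numbers[of f n] ind[of 1 r] f(1) fn nn by (simp add: n_def)
  next
    case False
    then have k: "s - r \<noteq> 0" by simp
    show ?thesis
      using split[of f "scale (1 / (s - r)) n"] ind[of "1 / (s - r)" r] f(1) fn
        scaled_idempotent[OF nn k] k by (simp add: n_def)
  qed
qed

end

section \<open>The operator and the functional behind the structure\<close>

context jacobi_novikov_poisson_algebra
begin

abbreviation "D b \<equiv> \<one> \<star> b"

lemma nov_eq_mult_D: "a \<star> b = a \<cdot> D b"
  using mult_nov[of a \<one> b] by simp

lemma D_mult: "D (a \<cdot> b) = D a \<cdot> b + a \<cdot> D b - a \<cdot> b \<cdot> D \<one>"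
  by (rule nov_mult)

lemma D_zero [simp]: "D 0 = 0"
  using bilinear_mapD(4)[OF bilinear_nov, of \<one> 0 0] by simp

text \<open>The derivation \<open>x \<mapsto> D x - x \<cdot> D \<one>\<close> kills every idempotent.\<close>

lemma D_idempotent:
  assumes "e \<cdot> e = e"
  shows "D e = e \<cdot> D \<one>"
proof -
  have De: "D e = D e \<cdot> e + e \<cdot> D e - e \<cdot> D \<one>"
    using D_mult[of e e] assms by simp
  have ee: "e \<cdot> (e \<cdot> w) = e \<cdot> w" for w
    using assoc[of e e w] assms by simp
  have "e \<cdot> D e = e \<cdot> (D e \<cdot> e + e \<cdot> D e - e \<cdot> D \<one>)"
    by (rule arg_cong[OF De])
  also have "\<dots> = e \<cdot> D e + e \<cdot> D e - e \<cdot> D \<one>"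
    by (simp only: mult_add mult_diff ee commute[of "D e" e])
  finally have eDe: "e \<cdot> D e = e \<cdot> D \<one>" by simp
  show ?thesis
    using De unfolding commute[of "D e" e] eDe by simp
qed

end

context quadratic_jacobi_novikov_poisson_algebra
begin

abbreviation "tr x \<equiv> form \<one> x"

lemma tr_linear [simp]:
  "tr (x + y) = tr x + tr y" "tr (scale k x) = k * tr x"
  using bilinear_mapD[OF bilinear_form] by auto

lemma tr_simps [simp]: "tr 0 = 0" "tr (- x) = - tr x" "tr (x - y) = tr x - tr y"
proof -
  show z: "tr 0 = 0" using tr_linear(2)[of 0 0] by simp
  show m: "tr (- x) = - tr x" for x using tr_linear(2)[of "- 1" x] by simp
  show "tr (x - y) = tr x - tr y" using tr_linear(1)[of x "- y"] m by simp
qed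

lemma form_eq_tr: "form x y = tr (x \<cdot> y)"
  using form_mult[of \<one> x y] by simp

text \<open>This is the invariance condition on the form with both of the outer arguments equal to \<open>\<one>\<close>.\<close>

lemma tr_D: "tr (D x) = - 2 * tr (x \<cdot> D \<one>)"
proof -
  have "tr (D x) = form (D x) \<one>" by (rule form_sym)
  also have "\<dots> = - form x (D \<one> + D \<one>)" by (rule form_nov)
  also have "\<dots> = - 2 * tr (x \<cdot> D \<one>)"
    unfolding form_eq_tr[of x] mult_add by simp
  finally show ?thesis .
qed

text \<open>An element that spans an ideal would be orthogonal to the whole algebra if \<open>tr\<close> killed it.\<close>

lemma tr_simple_ideal_nonzero:
  assumes "x \<noteq> 0" "\<And>y. \<exists>k. x \<cdot> y = scale k x"
  shows "tr x \<noteq> 0"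
proof
  assume tr: "tr x = 0"
  have "form x y = 0" for y
  proof -
    obtain k where "x \<cdot> y = scale k x" using assms(2) by blast
    then have "form x y = k * tr x" by (simp add: form_eq_tr[of x y])
    then show ?thesis using tr by simp
  qed
  then have "x = 0" by (rule form_nondegenerate)
  then show False using assms(1) by simp
qed

end

locale complex_quadratic3 =
  quadratic_jacobi_novikov_poisson_algebra scale mult unit nov form +
  complex_algebra3 scale mult unit
  for scale :: "complex \<Rightarrow> 'a::ab_group_add \<Rightarrow> 'a"
    and mult :: "'a \<Rightarrow> 'a \<Rightarrow> 'a" (infixl "\<cdot>" 70)
    and unit :: 'a ("\<one>")
    and nov :: "'a \<Rightarrow> 'a \<Rightarrow> 'a" (infixl "\<star>" 70)
    and form :: "'a \<Rightarrow> 'a \<Rightarrow> complex"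
begin

definition realised_by :: "mult_table \<Rightarrow> mult_table \<Rightarrow> gram_matrix \<Rightarrow> bool" where
  "realised_by A N G \<longleftrightarrow> (\<exists>\<phi>. quadratic_jacobi_novikov_poisson_iso
      scale mult unit nov form (*s) (table_op A) e1 (table_op N) (gram_form G) \<phi>)"

definition comb :: "'a \<Rightarrow> 'a \<Rightarrow> complex^3 \<Rightarrow> 'a" where
  "comb y z c = scale (c $ 1) \<one> + scale (c $ 2) y + scale (c $ 3) z"

text \<open>The linear map \<^term>\<open>comb y z\<close> from \<open>\<complex>\<^sup>3\<close> is bijective. By bilinearity it respects the operations
  once it does so on basis vectors, so \<open>isomorphism_of_pullback\<close> applies; its inverse is the
  isomorphism. It suffices to compute \<open>\<cdot>\<close>, \<open>D\<close> and \<open>tr\<close> on the basis.\<close>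

lemma realised_by_basis:
  assumes ind: "lin_indep3 \<one> y z"
    and A: "\<And>i j. (vector [\<one>, y, z] :: 'a^3) $ i \<cdot> (vector [\<one>, y, z] :: 'a^3) $ j =
      comb y z (A $ i $ j)"
    and D: "\<And>i j. (vector [\<one>, y, z] :: 'a^3) $ i \<cdot> D ((vector [\<one>, y, z] :: 'a^3) $ j) =
      comb y z (N $ i $ j)"
    and G: "\<And>i j. tr ((vector [\<one>, y, z] :: 'a^3) $ i \<cdot> (vector [\<one>, y, z] :: 'a^3) $ j) =
      G $ i $ j"
  shows "realised_by A N G"
proof -
  let ?v = "vector [\<one>, y, z] :: 'a^3"
  let ?L = "comb y z"
  have L: "?L = (\<lambda>c. \<Sum>i\<in>UNIV. scale (c $ i) (?v $ i))"
    by (simp add: comb_def sum_3 fun_eq_iff)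
  have bij: "bij ?L"
    unfolding L by (rule basis_combination_bij) (simp add: ind)
  have vs: "vector_space scale" ..
  have lin: "Vector_Spaces.linear (*s) scale ?L"
    using vs vec.vector_space_axioms
    by (simp add: Vector_Spaces.linear_iff comb_def algebra_simps)
  have add: "?L (x + y) = ?L x + ?L y" and sc: "?L (k *s x) = scale k (?L x)" for x y k
    using lin by (auto simp: Vector_Spaces.linear_iff)
  note bil = bilinear_mapD[OF bilinear_mult] bilinear_mapD[OF bilinear_nov]
    bilinear_mapD[OF bilinear_form]
  have N: "?v $ i \<star> ?v $ j = ?L (N $ i $ j)" for i j
    using D[of i j] nov_eq_mult_D[of "?v $ i" "?v $ j"] by (simp only:)
  have F: "form (?v $ i) (?v $ j) = G $ i $ j" for i j
    using G[of i j] form_eq_tr[of "?v $ i" "?v $ j"] by (simp only:)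
  have m: "?L (table_op A a b) = ?L a \<cdot> ?L b" for a b
    unfolding table_op_def sum_3 add sc A[symmetric]
    unfolding L sum_3 bil scale_right_distrib scale_scale
    by (simp only: ac_simps)
  have n: "?L (table_op N a b) = ?L a \<star> ?L b" for a b
    unfolding table_op_def sum_3 add sc N[symmetric]
    unfolding L sum_3 bil scale_right_distrib scale_scale
    by (simp only: ac_simps)
  have f: "gram_form G a b = form (?L a) (?L b)" for a b
    unfolding gram_form_def sum_3 F[symmetric]
    unfolding L sum_3 bil distrib_left
    by (simp only: ac_simps)
  have u: "?L e1 = \<one>" by (simp add: comb_def axis_def)
  from isomorphism_of_pullback[OF lin bij m u n f]
  show ?thesis unfolding realised_by_def by blast
qed

end

section \<open>The algebra generated by a nilpotent of index three\<close>

context complex_quadratic3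
begin

text \<open>Any \<open>a x + b x\<^sup>2\<close> with \<open>a \<noteq> 0\<close> generates the algebra as well as \<open>x\<close>. So the nilpotent part of
  \<open>D \<one>\<close> can serve as the generator unless it is a multiple \<open>b x\<^sup>2\<close>; in that case, if \<open>b \<noteq> 0\<close>, it is
  the square of the generator \<open>\<surd>b x\<close>.\<close>

lemma uniserial_normal_form:
  assumes x: "x \<cdot> x \<cdot> x = 0" "x \<cdot> x \<noteq> 0"
  obtains y k1 c2 c3 where "y \<cdot> y \<cdot> y = 0" "y \<cdot> y \<noteq> 0"
    "D \<one> = scale k1 \<one> + scale c2 y + scale c3 (y \<cdot> y)"
    "c2 = 0 \<and> c3 = 0 \<or> c2 = 0 \<and> c3 = 1 \<or> c2 = 1 \<and> c3 = 0"
proof -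
  obtain k1 a b where p: "D \<one> = scale k1 \<one> + scale a x + scale b (x \<cdot> x)"
    using lin_indep3_spans[OF nilpotent_powers_indep[OF x]] .
  have x3: "x \<cdot> (x \<cdot> x) = 0" using x(1) by (simp add: assoc)
  have x4: "x \<cdot> (x \<cdot> (x \<cdot> x)) = 0" using x3 by simp
  consider "a \<noteq> 0" | "a = 0" "b \<noteq> 0" | "a = 0" "b = 0" by blast
  then show ?thesis
  proof cases
    case 1
    let ?y = "scale a x + scale b (x \<cdot> x)"
    have yy: "?y \<cdot> ?y = scale (a * a) (x \<cdot> x)"
      by (simp add: mult_add assoc x3 x4)
    have "?y \<cdot> ?y \<cdot> ?y = 0"
      unfolding yy by (simp add: mult_add assoc x3 x4)
    moreover have "?y \<cdot> ?y \<noteq> 0" unfolding yy using 1 x by simp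
    ultimately show ?thesis
      using that[of ?y k1 1 0] p by (simp add: add.assoc)
  next
    case 2
    have b: "csqrt b * csqrt b = b" using power2_csqrt[of b] by (simp only: power2_eq_square)
    show ?thesis
      by (rule that[of "scale (csqrt b) x" k1 0 1]) (use 2 x p in \<open>simp_all add: b\<close>)
  next
    case 3
    then show ?thesis using that[of x k1 0 0] p x by simp
  qed
qed

text \<open>The product rule applied to \<open>x\<^sup>3 = 0\<close> removes the constant term of \<open>D x\<close> and applied to
  \<open>x \<cdot> x\<close> gives \<open>D x\<^sup>2\<close>. The three equations are the trace identity for \<open>x\<^sup>2\<close>, \<open>x\<close> and \<open>\<one>\<close>;
  \<open>g11\<close>, \<open>g12\<close>, \<open>g13\<close> are the values of \<open>tr\<close> there, in reverse order.\<close>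

lemma uniserial_realised:
  assumes x: "x \<cdot> x \<cdot> x = 0" "x \<cdot> x \<noteq> 0"
    and p: "D \<one> = scale k1 \<one> + scale c2 x + scale c3 (x \<cdot> x)"
  obtains k2 k3 g11 g12 g13 where "g13 \<noteq> 0" "2 * k2 = - k1"
    "3 * k1 * g12 + 2 * (k3 + 2 * c2) * g13 = 0" "k1 * g11 + c2 * g12 + c3 * g13 = 0"
    "realised_by table_A1
      (mat3 [[k1 *s e1 + c2 *s e2 + c3 *s e3, k2 *s e2 + k3 *s e3, (2 * k2 - k1) *s e3],
             [k1 *s e2 + c2 *s e3, k2 *s e3, 0],
             [k1 *s e3, 0, 0]])
      (mat3 [[g11, g12, g13],
             [g12, g13, 0],
             [g13, 0, 0]])"
proof -
  have ind: "lin_indep3 \<one> x (x \<cdot> x)" by (rule nilpotent_powers_indep[OF x])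
  have x3: "x \<cdot> (x \<cdot> x) = 0" using x(1) by (simp add: assoc)
  have x4: "x \<cdot> (x \<cdot> (x \<cdot> x)) = 0" using x3 by simp
  have px: "x \<cdot> D \<one> = scale k1 x + scale c2 (x \<cdot> x)"
    and pxx: "x \<cdot> x \<cdot> D \<one> = scale k1 (x \<cdot> x)"
    unfolding p by (simp_all add: mult_add assoc x3 x4)
  obtain w0 k2 k3 where Dx': "D x = scale w0 \<one> + scale k2 x + scale k3 (x \<cdot> x)"
    using lin_indep3_spans[OF ind] .
  have double: "scale (k * 2) y = scale k y + scale k y" for k y
    unfolding mult_2_right by (rule scale_left_distrib)
  have Dxx': "D (x \<cdot> x) = scale (2 * w0) x + scale (2 * k2 - k1) (x \<cdot> x)"
    unfolding D_mult pxx Dx' by (simp add: mult_add assoc x3 x4 double algebra_simps)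
  have "0 = D (x \<cdot> x \<cdot> x)" using x(1) by simp
  also have "\<dots> = scale (3 * w0) (x \<cdot> x)"
    unfolding D_mult[of "x \<cdot> x" x] Dxx' unfolding Dx' p
    by (simp add: mult_add assoc x3 x4 scale_left_distrib[symmetric])
  finally have w0: "w0 = 0" using x(2) by simp
  have Dx: "D x = scale k2 x + scale k3 (x \<cdot> x)" and Dxx: "D (x \<cdot> x) = scale (2 * k2 - k1) (x \<cdot> x)"
    using Dx' Dxx' w0 by simp_all
  have g13: "tr (x \<cdot> x) \<noteq> 0"
  proof (rule tr_simple_ideal_nonzero[OF x(2)])
    fix y
    obtain a b c where "y = scale a \<one> + scale b x + scale c (x \<cdot> x)"
      using lin_indep3_spans[OF ind] .
    then have "x \<cdot> x \<cdot> y = scale a (x \<cdot> x)" by (simp add: mult_add assoc x3 x4)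
    then show "\<exists>k. x \<cdot> x \<cdot> y = scale k (x \<cdot> x)" by blast
  qed
  have "(2 * k2 - k1) * tr (x \<cdot> x) = - 2 * (k1 * tr (x \<cdot> x))"
    using tr_D[of "x \<cdot> x"] unfolding Dxx pxx by simp
  then have "(2 * k2 + k1) * tr (x \<cdot> x) = 0" by (simp add: algebra_simps)
  then have k2: "2 * k2 = - k1" using g13 by (simp add: add_eq_0_iff)
  have "k2 * tr x + k3 * tr (x \<cdot> x) = - 2 * (k1 * tr x + c2 * tr (x \<cdot> x))"
    using tr_D[of x] unfolding Dx px by simp
  then have "(2 * k2) * tr x + 2 * k3 * tr (x \<cdot> x) + 4 * (k1 * tr x + c2 * tr (x \<cdot> x)) = 0"
    by algebra
  then have eq2: "3 * k1 * tr x + 2 * (k3 + 2 * c2) * tr (x \<cdot> x) = 0"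
    unfolding k2 by (simp add: algebra_simps)
  have "tr (D \<one>) = 0" using tr_D[of \<one>] by simp
  then have eq1: "k1 * tr \<one> + c2 * tr x + c3 * tr (x \<cdot> x) = 0" by (simp add: p)
  show ?thesis
  proof (rule that[OF g13 k2 eq2 eq1], rule realised_by_basis[OF ind])
    let ?v = "vector [\<one>, x, x \<cdot> x] :: 'a^3"
    fix i j :: 3
    show "?v $ i \<cdot> ?v $ j = comb x (x \<cdot> x) (table_A1 $ i $ j)"
      using exhaust_3[of i] exhaust_3[of j]
      by (auto simp: comb_def table_A1_def axis_def x3 x4 assoc)
    show "?v $ i \<cdot> D (?v $ j) = comb x (x \<cdot> x)
      ((mat3 [[k1 *s e1 + c2 *s e2 + c3 *s e3, k2 *s e2 + k3 *s e3, (2 * k2 - k1) *s e3],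
             [k1 *s e2 + c2 *s e3, k2 *s e3, 0],
             [k1 *s e3, 0, 0]]) $ i $ j)"
      using exhaust_3[of i] exhaust_3[of j]
      by (elim disjE) (simp_all add: comb_def axis_def Dx Dxx p mult_add x3 x4 assoc)
    show "tr (?v $ i \<cdot> ?v $ j) = (mat3 [[tr \<one>, tr x, tr (x \<cdot> x)],
             [tr x, tr (x \<cdot> x), 0],
             [tr (x \<cdot> x), 0, 0]]) $ i $ j"
      using exhaust_3[of i] exhaust_3[of j]
      by (elim disjE) (simp_all add: x3 x4 assoc)
  qed
qed

text \<open>The normal forms \<open>0\<close>, \<open>x\<^sup>2\<close>, \<open>x\<close> of the nilpotent part of \<open>D \<one>\<close> lead to the families \<open>J1a\<close>
  and \<open>J1b\<close>, to \<open>J2\<close> and to \<open>J4\<close> respectively. For \<open>k1 \<noteq> 0\<close> the trace equations determine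
  \<open>g11\<close> and \<open>g12\<close>. For \<open>k1 = 0\<close> they fix \<open>k3\<close> in the first and the third case, where \<open>g11\<close>
  stays free, and contradict \<open>g13 \<noteq> 0\<close> in the second.\<close>

lemma uniserial_classified:
  assumes "x \<cdot> x \<cdot> x = 0" "x \<cdot> x \<noteq> 0"
  shows "\<exists>A N G. qjnp_list A N G \<and> realised_by A N G"
proof -
  obtain y k1 c2 c3 where y: "y \<cdot> y \<cdot> y = 0" "y \<cdot> y \<noteq> 0"
    and p: "D \<one> = scale k1 \<one> + scale c2 y + scale c3 (y \<cdot> y)"
    and c: "c2 = 0 \<and> c3 = 0 \<or> c2 = 0 \<and> c3 = 1 \<or> c2 = 1 \<and> c3 = 0"
    using uniserial_normal_form[OF assms] .
  obtain k2 k3 g11 g12 g13 where g13: "g13 \<noteq> 0" and k2: "2 * k2 = - k1"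
    and eq2: "3 * k1 * g12 + 2 * (k3 + 2 * c2) * g13 = 0"
    and eq1: "k1 * g11 + c2 * g12 + c3 * g13 = 0"
    and R: "realised_by table_A1
      (mat3 [[k1 *s e1 + c2 *s e2 + c3 *s e3, k2 *s e2 + k3 *s e3, (2 * k2 - k1) *s e3],
             [k1 *s e2 + c2 *s e3, k2 *s e3, 0],
             [k1 *s e3, 0, 0]])
      (mat3 [[g11, g12, g13],
             [g12, g13, 0],
             [g13, 0, 0]])"
    using uniserial_realised[OF y p] .
  have k2': "k2 = - k1 / 2" using k2 by (simp add: field_simps)
  have g12: "g12 = - ((2 * k3 + 4 * c2) / (3 * k1)) * g13" if "k1 \<noteq> 0"
    using eq2 that by (simp add: field_simps add_eq_0_iff)
  from c show ?thesis
  proof (elim disjE)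
    assume c: "c2 = 0 \<and> c3 = 0"
    show ?thesis
    proof (cases "k1 = 0")
      case True
      then have "k2 = 0" "k3 = 0" using k2 eq2 c g13 by simp_all
      then have "mat3 [[k1 *s e1 + c2 *s e2 + c3 *s e3, k2 *s e2 + k3 *s e3, (2 * k2 - k1) *s e3],
             [k1 *s e2 + c2 *s e3, k2 *s e3, 0],
             [k1 *s e3, 0, 0]] = 0"
        using c True by (simp add: vec_eq_iff forall_3)
      then show ?thesis using R J1a[OF g13] by metis
    next
      case False
      then have "g11 = 0" using eq1 c by simp
      then show ?thesis
        using R J1b[OF g13 False k2', of k3] g12[OF False] c by auto
    qed
  next
    assume c: "c2 = 0 \<and> c3 = 1"
    have k1: "k1 \<noteq> 0" using eq1 c g13 by auto
    have "g11 = - (1 / k1) * g13"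
      using eq1 c k1 by (simp add: field_simps add_eq_0_iff)
    then show ?thesis
      using R J2[OF g13 k1 k2', of k3] g12[OF k1] c by auto
  next
    assume c: "c2 = 1 \<and> c3 = 0"
    show ?thesis
    proof (cases "k1 = 0")
      case True
      then have k: "k2 = 0" "g12 = 0" and "2 * k3 + 4 = 0" using k2 eq2 eq1 c g13 by simp_all
      then have "2 * k3 = 2 * (- 2)" by (simp add: add_eq_0_iff2)
      then have "k3 = - 2" by (simp only: mult_cancel_left) simp
      then show ?thesis
        using R J4[OF g13, of k1 k2 k3 _ g11] True k c by auto
    next
      case False
      have "g11 = - g12 / k1" using eq1 c False by (simp add: field_simps add_eq_0_iff)
      then have "g11 = (2 * k3 + 4) / (3 * k1\<^sup>2) * g13"
        using g12[OF False] c False by (simp add: field_simps power2_eq_square)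
      then show ?thesis
        using R J4[OF g13, of k1 k2 k3] g12[OF False] k2' False c by auto
    qed
  qed
qed

section \<open>Products of the complex numbers with another algebra\<close>

text \<open>The trace identity for \<open>e\<close> makes \<open>D \<one>\<close> vanish on the factor \<open>\<complex> e\<close>, hence \<open>D e = 0\<close>; for
  \<open>n\<close> it determines the eigenvalue \<open>- 2 b\<close> of \<open>D\<close>. The identity for \<open>\<one>\<close> then relates \<open>tr \<one>\<close>
  to the nilpotent coordinate \<open>c\<close> of \<open>D \<one>\<close>. Rescaling \<open>n\<close> reduces \<open>c\<close> to \<open>0\<close> (family \<open>J6\<close>) or
  \<open>1\<close> (family \<open>J5\<close>).\<close>

lemma dual_numbers_classified:
  assumes "lin_indep3 \<one> e n'" and ee: "e \<cdot> e = e" and "e \<cdot> n' = 0" "n' \<cdot> n' = 0"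
  shows "\<exists>A N G. qjnp_list A N G \<and> realised_by A N G"
proof -
  obtain b a c' where p': "D \<one> = scale b \<one> + scale a e + scale c' n'"
    using lin_indep3_spans[OF assms(1)] .
  obtain n c where ind: "lin_indep3 \<one> e n" and en: "e \<cdot> n = 0" and nn: "n \<cdot> n = 0"
    and p: "D \<one> = scale b \<one> + scale a e + scale c n" and c: "c = 0 \<or> c = 1"
  proof (cases "c' = 0")
    case True
    then show ?thesis using that[of n' 0] assms p' by simp
  next
    case False
    have "lin_indep3 \<one> e (scale c' n')"
      unfolding lin_indep3_def
    proof (intro allI impI)
      fix k l m assume "scale k \<one> + scale l e + scale m (scale c' n') = 0"
      then have "scale k \<one> + scale l e + scale (m * c') n' = 0" by simp
      from lin_indep3D[OF assms(1) this] show "k = 0 \<and> l = 0 \<and> m = 0" using False by simp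
    qed
    then show ?thesis using that[of "scale c' n'" 1] assms p' by simp
  qed
  have ne: "n \<cdot> e = 0" using en by (simp add: commute)
  have nz: "e \<noteq> 0" "n \<noteq> 0"
    using lin_indep3D(2)[OF ind, of 0 1 0] lin_indep3D(3)[OF ind, of 0 0 1] by auto
  have basis: "\<exists>a b c. y = scale a \<one> + scale b e + scale c n" for y
    using lin_indep3_spans[OF ind] by metis
  have "\<exists>k. e \<cdot> y = scale k e" for y
  proof -
    obtain a b c where "y = scale a \<one> + scale b e + scale c n" using basis by blast
    then have "e \<cdot> y = scale (a + b) e" by (simp add: mult_add ee en scale_left_distrib)
    then show ?thesis by blast
  qed
  from tr_simple_ideal_nonzero[OF nz(1) this] have g12: "tr e \<noteq> 0" .
  have "\<exists>k. n \<cdot> y = scale k n" for y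
  proof -
    obtain a b c where "y = scale a \<one> + scale b e + scale c n" using basis by blast
    then have "n \<cdot> y = scale a n" by (simp add: mult_add ne nn)
    then show ?thesis by blast
  qed
  from tr_simple_ideal_nonzero[OF nz(2) this] have g13: "tr n \<noteq> 0" .
  have ep: "e \<cdot> D \<one> = scale (b + a) e" and np: "n \<cdot> D \<one> = scale b n"
    unfolding p by (simp_all add: mult_add ee en ne nn scale_left_distrib)
  have De': "D e = scale (b + a) e" using D_idempotent[OF ee] ep by simp
  have "(b + a) * tr e = - 2 * ((b + a) * tr e)"
    using tr_D[of e] unfolding De' ep by simp
  then have "3 * ((b + a) * tr e) = 0" by (simp add: algebra_simps)
  then have "b + a = 0" using g12 by simp
  then have a: "a = - b" by (simp add: add_eq_0_iff)
  have De: "D e = 0" using De' a by simp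
  obtain u v w where Dn': "D n = scale u \<one> + scale v e + scale w n" using basis by blast
  have "D (n \<cdot> n) = scale (2 * u) n"
    unfolding D_mult[of n n] unfolding Dn'
    using scale_left_distrib[of u u n] by (simp add: mult_add nn ne en)
  then have u: "u = 0" using nn nz by simp
  have "D (e \<cdot> n) = scale v e"
    unfolding D_mult[of e n] unfolding De Dn' by (simp add: mult_add u en ee)
  then have v: "v = 0" using en nz by simp
  have "w * tr n = - 2 * (b * tr n)"
    using tr_D[of n] unfolding np unfolding Dn' u v by simp
  then have "(w + 2 * b) * tr n = 0" by (simp add: algebra_simps)
  then have "w = - 2 * b" using g13 by (simp add: add_eq_0_iff2)
  then have Dn: "D n = scale (- 2 * b) n" using Dn' u v by simp
  have "tr (D \<one>) = 0" using tr_D[of \<one>] by simp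
  then have eq: "b * (tr \<one> - tr e) + c * tr n = 0" by (simp add: p a algebra_simps)
  have R: "realised_by table_A2
      (mat3 [[b *s e1 + (- b) *s e2 + c *s e3, (b + - b) *s e2, (- 2 * b) *s e3],
             [(b + - b) *s e2, (b + - b) *s e2, 0],
             [b *s e3, 0, 0]])
      (mat3 [[tr \<one>, tr e, tr n],
             [tr e, tr e, 0],
             [tr n, 0, 0]])" (is "realised_by _ ?N ?G")
  proof (rule realised_by_basis[OF ind])
    let ?v = "vector [\<one>, e, n] :: 'a^3"
    fix i j :: 3
    show "?v $ i \<cdot> ?v $ j = comb e n (table_A2 $ i $ j)"
      using exhaust_3[of i] exhaust_3[of j]
      by (elim disjE) (simp_all add: comb_def table_A2_def axis_def ee en ne nn)
    show "?v $ i \<cdot> D (?v $ j) = comb e n (?N $ i $ j)"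
      using exhaust_3[of i] exhaust_3[of j]
      by (elim disjE) (simp_all add: comb_def axis_def De Dn p a mult_add mult_diff ee en ne nn)
    show "tr (?v $ i \<cdot> ?v $ j) = ?G $ i $ j"
      using exhaust_3[of i] exhaust_3[of j]
      by (elim disjE) (simp_all add: ee en ne nn)
  qed
  from c show ?thesis
  proof
    assume c: "c = 0"
    show ?thesis
    proof (cases "b = 0")
      case True
      then show ?thesis using R J6[OF g12 g13, of 0 0 0 _ "tr \<one>"] c by auto
    next
      case False
      then have "tr \<one> = tr e" using eq c by simp
      then show ?thesis using R J6[OF g12 g13, of b "- b" "- 2 * b"] c False by auto
    qed
  next
    assume c: "c = 1"
    then have b: "b \<noteq> 0" using eq g13 by auto
    then have "tr \<one> = tr e - 1 / b * tr n" using eq c by (simp add: field_simps)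
    then show ?thesis using R J5[OF g12 g13 b, of "- b" "- 2 * b"] c by auto
  qed
qed

text \<open>On each primitive idempotent \<open>f\<close> the trace identity reads \<open>k tr f = - 2 k tr f\<close>, where \<open>k\<close> is the
  coordinate of \<open>D \<one>\<close> at \<open>f\<close>. So \<open>D \<one> = 0\<close>, and \<open>D\<close> vanishes on the idempotents. The three
  inequalities of \<open>J7\<close> say that \<open>tr\<close> is nonzero on the three primitive idempotents.\<close>

lemma split_classified:
  assumes ind: "lin_indep3 \<one> e h" and ee: "e \<cdot> e = e" and eh: "e \<cdot> h = 0" and hh: "h \<cdot> h = h"
  shows "\<exists>A N G. qjnp_list A N G \<and> realised_by A N G"
proof -
  have he: "h \<cdot> e = 0" using eh by (simp add: commute)
  have basis: "\<exists>a b c. y = scale a \<one> + scale b e + scale c h" for y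
    using lin_indep3_spans[OF ind] by metis
  have key: "tr f \<noteq> 0 \<and> f \<cdot> D \<one> = 0"
    if f: "f \<noteq> 0" "f \<cdot> f = f" and min: "\<And>y. \<exists>k. f \<cdot> y = scale k f" for f
  proof -
    have t: "tr f \<noteq> 0" using tr_simple_ideal_nonzero f(1) min by blast
    obtain k where k: "f \<cdot> D \<one> = scale k f" using min by blast
    have "k * tr f = - 2 * (k * tr f)"
      using tr_D[of f] unfolding D_idempotent[OF f(2)] k by simp
    then have "3 * (k * tr f) = 0" by (simp add: algebra_simps)
    then show ?thesis using t k by simp
  qed
  define f where "f = \<one> - e - h"
  have nz: "e \<noteq> 0" "h \<noteq> 0" "f \<noteq> 0"
    using lin_indep3D(2)[OF ind, of 0 1 0] lin_indep3D(3)[OF ind, of 0 0 1]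
      lin_indep3D(1)[OF ind, of 1 "- 1" "- 1"] by (auto simp: f_def)
  have ff: "f \<cdot> f = f" by (simp add: f_def mult_diff ee eh he hh)
  have "\<exists>k. e \<cdot> y = scale k e" for y
  proof -
    obtain a b c where "y = scale a \<one> + scale b e + scale c h" using basis by blast
    then have "e \<cdot> y = scale (a + b) e" by (simp add: mult_add ee eh scale_left_distrib)
    then show ?thesis by blast
  qed
  from key[OF nz(1) ee this] have e: "tr e \<noteq> 0" "e \<cdot> D \<one> = 0" by auto
  have "\<exists>k. h \<cdot> y = scale k h" for y
  proof -
    obtain a b c where "y = scale a \<one> + scale b e + scale c h" using basis by blast
    then have "h \<cdot> y = scale (a + c) h" by (simp add: mult_add he hh scale_left_distrib)
    then show ?thesis by blast
  qed
  from key[OF nz(2) hh this] have h: "tr h \<noteq> 0" "h \<cdot> D \<one> = 0" by auto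
  have "\<exists>k. f \<cdot> y = scale k f" for y
  proof -
    obtain a b c where "y = scale a \<one> + scale b e + scale c h" using basis by blast
    then have "f \<cdot> y = scale a f" by (simp add: f_def mult_add mult_diff ee eh he hh)
    then show ?thesis by blast
  qed
  from key[OF nz(3) ff this] have f: "tr f \<noteq> 0" "f \<cdot> D \<one> = 0" by auto
  have D1: "D \<one> = 0" using f(2) e(2) h(2) by (simp add: f_def mult_diff)
  have De: "D e = 0" "D h = 0" using D_idempotent[OF ee] D_idempotent[OF hh] D1 by simp_all
  have "realised_by table_A3 0 (mat3 [[tr \<one>, tr e, tr h], [tr e, tr e, 0], [tr h, 0, tr h]])"
    (is "realised_by _ _ ?G")
  proof (rule realised_by_basis[OF ind])
    let ?v = "vector [\<one>, e, h] :: 'a^3"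
    fix i j :: 3
    show "?v $ i \<cdot> ?v $ j = comb e h (table_A3 $ i $ j)"
      using exhaust_3[of i] exhaust_3[of j]
      by (elim disjE) (simp_all add: comb_def table_A3_def axis_def ee eh he hh)
    show "?v $ i \<cdot> D (?v $ j) = comb e h (0 $ i $ j)"
      using exhaust_3[of j] by (elim disjE) (simp_all add: comb_def D1 De)
    show "tr (?v $ i \<cdot> ?v $ j) = ?G $ i $ j"
      using exhaust_3[of i] exhaust_3[of j]
      by (elim disjE) (simp_all add: ee eh he hh)
  qed
  moreover have "tr \<one> \<noteq> tr e + tr h" using f(1) by (simp add: f_def algebra_simps)
  ultimately show ?thesis using J7[OF e(1) h(1)] by blast
qed

section \<open>Classification\<close>

text \<open>Each combination of \<open>u\<close> and \<open>v\<close> spans an ideal, yet \<open>tr\<close> has a kernel on their plane.\<close>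

lemma not_square_zero:
  assumes ind: "lin_indep3 \<one> u v" and uu: "u \<cdot> u = 0" and vv: "v \<cdot> v = 0" and uv: "u \<cdot> v = 0"
  shows False
proof -
  have vu: "v \<cdot> u = 0" using uv by (simp add: commute)
  have tr: "tr (scale k u + scale l v) \<noteq> 0" if "scale k u + scale l v \<noteq> 0" for k l
  proof (rule tr_simple_ideal_nonzero[OF that])
    fix y
    obtain a b c where "y = scale a \<one> + scale b u + scale c v"
      using lin_indep3_spans[OF ind] .
    then have "(scale k u + scale l v) \<cdot> y = scale a (scale k u + scale l v)"
      by (simp add: mult_add uu vv uv vu scale_right_distrib mult.commute)
    then show "\<exists>m. (scale k u + scale l v) \<cdot> y = scale m (scale k u + scale l v)" by blast
  qed
  have "tr (scale (tr v) u + scale (- tr u) v) = 0" by simp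
  then have "scale 0 \<one> + scale (tr v) u + scale (- tr u) v = 0" using tr by (metis add_0 scale_zero_left)
  from lin_indep3D(3)[OF ind this] have "tr u = 0" by simp
  moreover have "u \<noteq> 0" using lin_indep3D(2)[OF ind, of 0 1 0] by auto
  ultimately show False using tr[of 1 0] by simp
qed

lemma occurs_in_list: "\<exists>A N G. qjnp_list A N G \<and> realised_by A N G"
proof (cases "\<forall>e. e \<cdot> e = e \<longrightarrow> e = 0 \<or> e = \<one>")
  case True
  then have conn: "e = 0 \<or> e = \<one>" if "e \<cdot> e = e" for e using that by blast
  show ?thesis
    by (rule connected_structure[OF conn]) (use uniserial_classified not_square_zero in blast)+
next
  case False
  then obtain e where "e \<cdot> e = e" "e \<noteq> 0" "e \<noteq> \<one>" by blast
  then show ?thesis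
    by (rule disconnected_structure) (use dual_numbers_classified split_classified in blast)+
qed

end

theorem proposition3p12:
  fixes scale :: "complex \<Rightarrow> 'a::ab_group_add \<Rightarrow> 'a"
    and mult :: "'a \<Rightarrow> 'a \<Rightarrow> 'a" and unit :: 'a
    and nov :: "'a \<Rightarrow> 'a \<Rightarrow> 'a"
    and form :: "'a \<Rightarrow> 'a \<Rightarrow> complex"
  assumes "quadratic_jacobi_novikov_poisson_algebra scale mult unit nov form"
    and "vector_space.dim scale (UNIV :: 'a set) = 3"
  shows "\<exists>A N G \<phi>. qjnp_list A N G \<and>
    quadratic_jacobi_novikov_poisson_iso
      scale mult unit nov form
      (*s) (table_op A) e1 (table_op N) (gram_form G) \<phi>"
proof -
  interpret quadratic_jacobi_novikov_poisson_algebra scale mult unit nov form by (rule assms)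
  interpret complex_quadratic3 scale mult unit nov form
    by unfold_locales (rule assms(2))
  show ?thesis using occurs_in_list unfolding realised_by_def by blast
qed

end
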